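(* If $P'$ is a minor of a polymatroid $P$, then $I_{P'}\le I_P$ and $X_{P'}\le X_P$ coefficientwise.
   Context: A polymatroid on a finite totally ordered set $S$ is $P=\{\mathbf a\in\mathbb{Z}^S\mid \sum_{i\in I}a_i\le f(I)\ \forall I\subset S,\ \sum_{i\in S}a_i=f(S)\}$ with $f:2^S\to\mathbb{Z}$, $f(\emptyset)=0$, submodular (its rank function). For $A\subset S$, $P\setminus A$ and $P/A$ are the polymatroids on $S\setminus A$ with rank functions $T\mapsto f(T)$ and $T\mapsto f(T\cup A)-f(A)$. $P'$ is a minor of $P$ (on $[n]$) if $P'=(P\setminus A)/B$ or $P'=(P/B)\setminus A$ for disjoint $A,B\subset[n]$. For $\mathbf a\in P$, $i\in S$ is internally active if $\mathbf a-\mathbf e_i+\mathbf e_j\notin P$ for all $j<i$, externally active if $\mathbf a+\mathbf e_i-\mathbf e_j\notin P$ for all $j<i$. $I_P(x)=\sum_{\mathbf a\in P}x^{|S|-\#\text{internally active}}$, $X_P(y)=\sum_{\mathbf a\in P}y^{|S|-\#\text{externally active}}$. $g_1\le g_2$ means coefficientwise inequality. *)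

theory Defs
  imports "HOL-Library.FuncSet" "HOL-Computational_Algebra.Polynomial"
begin

text \<open>A finite totally ordered ground set is a finite subset of a linearly ordered type.
  Only the values of a rank function on subsets of the ground set matter.\<close>

definition is_rank_function :: "'a set \<Rightarrow> ('a set \<Rightarrow> int) \<Rightarrow> bool" where
  "is_rank_function S f \<longleftrightarrow>
     f {} = 0 \<and> (\<forall>I J. I \<subseteq> S \<longrightarrow> J \<subseteq> S \<longrightarrow> f (I \<union> J) + f (I \<inter> J) \<le> f I + f J)"

text \<open>\<open>\<int>\<^sup>S\<close> is encoded as the set of functions that are \<open>undefined\<close> outside \<open>S\<close>, so that a
  vector is determined by its entries indexed by \<open>S\<close>.\<close>

definition polymatroid_of :: "'a set \<Rightarrow> ('a set \<Rightarrow> int) \<Rightarrow> ('a \<Rightarrow> int) set" where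
  "polymatroid_of S f =
     {a \<in> S \<rightarrow>\<^sub>E UNIV. (\<forall>I\<subseteq>S. (\<Sum>i\<in>I. a i) \<le> f I) \<and> (\<Sum>i\<in>S. a i) = f S}"

definition is_polymatroid :: "'a set \<Rightarrow> ('a \<Rightarrow> int) set \<Rightarrow> bool" where
  "is_polymatroid S P \<longleftrightarrow> finite S \<and> (\<exists>f. is_rank_function S f \<and> P = polymatroid_of S f)"

text \<open>The rank function of a polymatroid \<open>P\<close> on \<open>S\<close>. It is unique on the subsets of \<open>S\<close>, so the
  choice is immaterial; see \<open>rank_function_polymatroid_of\<close> below.\<close>

definition rank_function :: "'a set \<Rightarrow> ('a \<Rightarrow> int) set \<Rightarrow> 'a set \<Rightarrow> int" where
  "rank_function S P = (SOME f. is_rank_function S f \<and> P = polymatroid_of S f)"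

definition deletion :: "'a set \<Rightarrow> ('a \<Rightarrow> int) set \<Rightarrow> 'a set \<Rightarrow> ('a \<Rightarrow> int) set" where
  "deletion S P A = polymatroid_of (S - A) (\<lambda>T. rank_function S P T)"

definition contraction :: "'a set \<Rightarrow> ('a \<Rightarrow> int) set \<Rightarrow> 'a set \<Rightarrow> ('a \<Rightarrow> int) set" where
  "contraction S P A =
     polymatroid_of (S - A) (\<lambda>T. rank_function S P (T \<union> A) - rank_function S P A)"

text \<open>The polymatroid \<open>P'\<close> on \<open>S'\<close> is a minor of the polymatroid \<open>P\<close> on \<open>S\<close>.\<close>

definition is_minor ::
  "'a set \<Rightarrow> ('a \<Rightarrow> int) set \<Rightarrow> 'a set \<Rightarrow> ('a \<Rightarrow> int) set \<Rightarrow> bool" where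
  "is_minor S' P' S P \<longleftrightarrow>
     (\<exists>A B. A \<subseteq> S \<and> B \<subseteq> S \<and> A \<inter> B = {} \<and> S' = S - (A \<union> B) \<and>
        (P' = contraction (S - A) (deletion S P A) B \<or>
         P' = deletion (S - B) (contraction S P B) A))"

text \<open>As \<open>j < i\<close>, the updates below are \<open>a - e\<^sub>i + e\<^sub>j\<close> and \<open>a + e\<^sub>i - e\<^sub>j\<close>.\<close>

definition internally_active ::
  "'a::linorder set \<Rightarrow> ('a \<Rightarrow> int) set \<Rightarrow> ('a \<Rightarrow> int) \<Rightarrow> 'a set" where
  "internally_active S P a = {i \<in> S. \<forall>j\<in>S. j < i \<longrightarrow> a(i := a i - 1, j := a j + 1) \<notin> P}"

definition externally_active ::
  "'a::linorder set \<Rightarrow> ('a \<Rightarrow> int) set \<Rightarrow> ('a \<Rightarrow> int) \<Rightarrow> 'a set" where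
  "externally_active S P a = {i \<in> S. \<forall>j\<in>S. j < i \<longrightarrow> a(i := a i + 1, j := a j - 1) \<notin> P}"

definition interior_poly :: "'a::linorder set \<Rightarrow> ('a \<Rightarrow> int) set \<Rightarrow> int poly" where
  "interior_poly S P = (\<Sum>a\<in>P. monom 1 (card S - card (internally_active S P a)))"

definition exterior_poly :: "'a::linorder set \<Rightarrow> ('a \<Rightarrow> int) set \<Rightarrow> int poly" where
  "exterior_poly S P = (\<Sum>a\<in>P. monom 1 (card S - card (externally_active S P a)))"

definition coeffwise_le :: "int poly \<Rightarrow> int poly \<Rightarrow> bool" where
  "coeffwise_le g h \<longleftrightarrow> (\<forall>k. coeff g k \<le> coeff h k)"


text \<open>The sums above are finite.\<close>

lemma finite_polymatroid_of:
  assumes "finite S"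
  shows "finite (polymatroid_of S f)"
proof (rule finite_subset)
  show "polymatroid_of S f \<subseteq> (\<Pi>\<^sub>E i\<in>S. {f S - f (S - {i})..f {i}})"
  proof
    fix a assume a: "a \<in> polymatroid_of S f"
    have "f S - f (S - {i}) \<le> a i \<and> a i \<le> f {i}" if i: "i \<in> S" for i
    proof -
      have "(\<Sum>k\<in>{i}. a k) \<le> f {i}" "(\<Sum>k\<in>S - {i}. a k) \<le> f (S - {i})" "(\<Sum>k\<in>S. a k) = f S"
        using a i unfolding polymatroid_of_def by blast+
      then show ?thesis using sum.remove[OF assms i, of a] by simp
    qed
    then show "a \<in> (\<Pi>\<^sub>E i\<in>S. {f S - f (S - {i})..f {i}})"
      using a by (auto simp: polymatroid_of_def PiE_iff)
  qed
  show "finite (\<Pi>\<^sub>E i\<in>S. {f S - f (S - {i})..f {i}})"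
    using assms by (intro finite_PiE) auto
qed

lemma is_rank_function_mono: "is_rank_function S f \<Longrightarrow> T \<subseteq> S \<Longrightarrow> is_rank_function T f"
  unfolding is_rank_function_def by blast

lemma polymatroid_extend:
  assumes "finite U" "finite T" "is_rank_function (T \<union> U) f" "a \<in> polymatroid_of T f"
  shows "\<exists>b\<in>polymatroid_of (T \<union> U) f. \<forall>i\<in>T. b i = a i"
  using assms
proof (induction U rule: finite_induct)
  case empty
  then show ?case by auto
next
  case (insert x U)
  let ?V = "T \<union> U"
  have rk: "is_rank_function (insert x ?V) f" using insert.prems by simp
  then have "is_rank_function ?V f" by (rule is_rank_function_mono) blast
  with insert obtain b where b: "b \<in> polymatroid_of ?V f" "\<forall>i\<in>T. b i = a i" by blast
  show ?case
  proof (cases "x \<in> ?V")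
    case True
    then have "T \<union> insert x U = ?V" by blast
    then show ?thesis unfolding \<open>T \<union> insert x U = ?V\<close> using b by blast
  next
    case False
    have finV: "finite ?V" using insert by simp
    let ?c = "b(x := f (insert x ?V) - f ?V)"
    have sum_c: "sum ?c I = sum b I" if "I \<subseteq> ?V" for I
      using that False by (intro sum.cong) auto
    have sb: "\<And>I. I \<subseteq> ?V \<Longrightarrow> sum b I \<le> f I" and sV: "sum b ?V = f ?V"
      using b(1) by (simp_all add: polymatroid_of_def)
    have tot: "sum ?c (insert x ?V) = f (insert x ?V)"
      using False finV sum_c[of ?V] sV by simp
    have "sum ?c I \<le> f I" if I: "I \<subseteq> insert x ?V" for I
    proof (cases "x \<in> I")
      case False
      then have "I \<subseteq> ?V" using I by blast
      then show ?thesis using sum_c sb by simp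
    next
      case True
      have J: "I - {x} \<subseteq> ?V" using I by blast
      have fI: "finite I" using I finV by (meson finite.insertI finite_subset)
      have "sum ?c I = ?c x + sum ?c (I - {x})" by (rule sum.remove[OF fI True])
      also have "\<dots> = f (insert x ?V) - f ?V + sum b (I - {x})" using sum_c[OF J] by simp
      also have "\<dots> \<le> f (insert x ?V) - f ?V + f (I - {x})" using sb[OF J] by simp
      also have "\<dots> \<le> f I"
      proof -
        have "f (I \<union> ?V) + f (I \<inter> ?V) \<le> f I + f ?V"
          using rk I unfolding is_rank_function_def by blast
        moreover have "I \<union> ?V = insert x ?V" "I \<inter> ?V = I - {x}"
          using I True \<open>x \<notin> ?V\<close> by auto
        ultimately show ?thesis by simp
      qed
      finally show ?thesis .
    qed
    moreover have "?c \<in> insert x ?V \<rightarrow>\<^sub>E UNIV"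
      using b(1) by (simp add: polymatroid_of_def PiE_iff extensional_def)
    ultimately have "?c \<in> polymatroid_of (insert x ?V) f"
      using tot by (simp add: polymatroid_of_def)
    moreover have "\<forall>i\<in>T. ?c i = a i" using b(2) False by auto
    ultimately have "\<exists>b\<in>polymatroid_of (insert x ?V) f. \<forall>i\<in>T. b i = a i"
      by - (rule bexI[where x = ?c])
    then show ?thesis by simp
  qed
qed

lemma rank_function_attained:
  assumes "finite S" "is_rank_function S f" "I \<subseteq> S"
  shows "\<exists>a\<in>polymatroid_of S f. sum a I = f I"
proof -
  have finI: "finite I" using assms finite_subset by blast
  have "(\<lambda>_. undefined) \<in> polymatroid_of {} f"
    using assms by (simp add: polymatroid_of_def is_rank_function_def)
  moreover have "is_rank_function ({} \<union> I) f"
    using assms is_rank_function_mono by simp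
  ultimately obtain a where a: "a \<in> polymatroid_of I f"
    using polymatroid_extend[of I "{}" f] finI by auto
  have eq: "I \<union> S = S" using assms by blast
  then obtain b where b: "b \<in> polymatroid_of S f" "\<forall>i\<in>I. b i = a i"
    using polymatroid_extend[of S I f a] a assms finI by auto
  have "sum b I = sum a I" using b by simp
  also have "\<dots> = f I" using a by (simp add: polymatroid_of_def)
  finally show ?thesis using b by blast
qed

lemma polymatroid_of_cong:
  assumes "\<And>I. I \<subseteq> S \<Longrightarrow> f I = g I"
  shows "polymatroid_of S f = polymatroid_of S g"
  using assms by (simp add: polymatroid_of_def)

lemma rank_function_polymatroid_of:
  assumes "finite S" "is_rank_function S f" "I \<subseteq> S"
  shows "rank_function S (polymatroid_of S f) I = f I"
proof -
  define g where "g = rank_function S (polymatroid_of S f)"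
  have "is_rank_function S g \<and> polymatroid_of S f = polymatroid_of S g"
    unfolding g_def rank_function_def by (rule someI[of _ f]) (use assms in simp)
  then have g: "is_rank_function S g" "polymatroid_of S f = polymatroid_of S g" by auto
  have bound: "sum a I \<le> h I" if "a \<in> polymatroid_of S h" for a h
    using that assms(3) unfolding polymatroid_of_def by blast
  obtain a where a: "a \<in> polymatroid_of S f" "sum a I = f I"
    using rank_function_attained[OF assms] by blast
  obtain b where b: "b \<in> polymatroid_of S g" "sum b I = g I"
    using rank_function_attained[OF assms(1) g(1) assms(3)] by blast
  have "f I \<le> g I" using a g(2) bound[of a g] by simp
  moreover have "g I \<le> f I" using b g(2) bound[of b f] by simp
  ultimately have "g I = f I" by simp
  then show ?thesis by (simp add: g_def)
qed

lemma deletion_polymatroid_of: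
  assumes "finite S" "is_rank_function S f"
  shows "deletion S (polymatroid_of S f) A = polymatroid_of (S - A) f"
  unfolding deletion_def
  by (rule polymatroid_of_cong) (use assms rank_function_polymatroid_of in blast)

lemma contraction_polymatroid_of:
  assumes "finite S" "is_rank_function S f" "A \<subseteq> S"
  shows "contraction S (polymatroid_of S f) A = polymatroid_of (S - A) (\<lambda>T. f (T \<union> A) - f A)"
  unfolding contraction_def
proof (rule polymatroid_of_cong)
  fix I assume "I \<subseteq> S - A"
  then have "I \<union> A \<subseteq> S" using assms by blast
  then show "rank_function S (polymatroid_of S f) (I \<union> A)
      - rank_function S (polymatroid_of S f) A = f (I \<union> A) - f A"
    using assms by (simp add: rank_function_polymatroid_of)
qed

end

theory Submission
  imports Defs "HOL-Computational_Algebra.Polynomial_FPS"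
begin

text \<open>The interior polynomial does not depend on the order of the ground set: every integer vector
  \<open>b\<close> below some point of \<open>P\<close> is uniquely \<open>a - c\<close> with \<open>a \<in> P\<close> and \<open>c \<ge> 0\<close> supported on the
  internally active elements of \<open>a\<close>, so with \<open>n = |S|\<close> and \<open>N\<^sub>k\<close> the number of such \<open>b\<close> with
  coordinate sum \<open>f(S) - k\<close> one has \<open>I\<^sub>P(1 - t) = (1 - t)\<^sup>n (\<Sum>k. N\<^sub>k t\<^sup>k)\<close>.

  For \<open>T \<subseteq> S\<close>, the face of \<open>P\<close> on which the coordinates in \<open>T\<close> sum to \<open>f(T)\<close> is the product of the
  restriction of \<open>P\<close> to \<open>T\<close> and the contraction of \<open>T\<close>. If \<open>T\<close> comes first in the order, the active
  set in \<open>P\<close> of a point of the face is the union of the active sets of its two components.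
  Gluing a fixed vector, all of whose elements are active, to the points of one factor therefore
  embeds this factor into \<open>P\<close> and keeps the number of inactive elements.

  Exterior activity in \<open>P\<close> is interior activity in \<open>-P\<close>, and negation exchanges deletion and
  contraction.\<close>

section \<open>Activity for an arbitrary ranking, and the exchange property\<close>

text \<open>Internal activity for the order that a ranking \<open>p\<close>, injective on \<open>S\<close>, induces on \<open>S\<close>.\<close>

definition active :: "('a \<Rightarrow> nat) \<Rightarrow> 'a set \<Rightarrow> ('a \<Rightarrow> int) set \<Rightarrow> ('a \<Rightarrow> int) \<Rightarrow> 'a set" where
  "active p S P a = {i \<in> S. \<forall>j\<in>S. p j < p i \<longrightarrow> a(i := a i - 1, j := a j + 1) \<notin> P}"

text \<open>The order is a parameter, so that different orders on one ground set can be
  compared.\<close>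

definition activity_poly :: "('a \<Rightarrow> nat) \<Rightarrow> 'a set \<Rightarrow> ('a \<Rightarrow> int) set \<Rightarrow> int poly" where
  "activity_poly p S P = (\<Sum>a\<in>P. monom 1 (card S - card (active p S P a)))"

lemma active_subset: "active p S P a \<subseteq> S"
  by (auto simp: active_def)

lemma coeff_activity_poly:
  assumes "finite P"
  shows "coeff (activity_poly p S P) k = int (card {a \<in> P. card S - card (active p S P a) = k})"
  using assms by (simp add: activity_poly_def coeff_sum sum.If_cases Int_def eq_commute)

lemma coeffwise_le_trans: "coeffwise_le g h \<Longrightarrow> coeffwise_le h k \<Longrightarrow> coeffwise_le g k"
  unfolding coeffwise_le_def using order_trans by blast

lemma activity_poly_coeffwise_le:
  assumes "finite P" "finite Q" "inj_on F Q" "F ` Q \<subseteq> P"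
    and "\<And>a. a \<in> Q \<Longrightarrow> card T - card (active p T Q a) = card S - card (active p S P (F a))"
  shows "coeffwise_le (activity_poly p T Q) (activity_poly p S P)"
proof -
  have "card {a \<in> Q. card T - card (active p T Q a) = k}
      \<le> card {a \<in> P. card S - card (active p S P a) = k}" for k
    by (rule card_inj_on_le[where f = F]) (use assms inj_on_subset[OF assms(3)] in auto)
  then show ?thesis
    using assms by (simp add: coeffwise_le_def coeff_activity_poly)
qed

lemma sum_transfer:
  fixes a :: "'a \<Rightarrow> int"
  assumes "finite I" "i \<noteq> j"
  shows "sum (a(i := a i - 1, j := a j + 1)) I = sum a I + of_bool (j \<in> I) - of_bool (i \<in> I)"
proof -
  have "sum (a(i := a i - 1, j := a j + 1)) I
      = (\<Sum>k\<in>I. a k + (if k = j then 1 else 0) - (if k = i then 1 else 0))"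
    using assms by (intro sum.cong) auto
  then show ?thesis
    using assms by (simp add: sum.distrib sum_subtractf)
qed

lemma polymatroid_ofD:
  assumes "a \<in> polymatroid_of S f"
  shows "a \<in> S \<rightarrow>\<^sub>E UNIV" "I \<subseteq> S \<Longrightarrow> sum a I \<le> f I" "sum a S = f S"
  using assms by (auto simp: polymatroid_of_def)

lemma rank_function_submodular:
  assumes "is_rank_function S f" "I \<subseteq> S" "J \<subseteq> S"
  shows "f (I \<union> J) + f (I \<inter> J) \<le> f I + f J"
  using assms by (auto simp: is_rank_function_def)

lemma polymatroid_exchange:
  assumes fin: "finite S" and rk: "is_rank_function S f"
    and a: "a \<in> polymatroid_of S f" and b: "b \<in> polymatroid_of S f"
    and i: "i \<in> S" and lt: "a i < b i"
  shows "\<exists>j\<in>S. b j < a j \<and> a(j := a j - 1, i := a i + 1) \<in> polymatroid_of S f"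
proof -
  \<comment> \<open>Tight sets are closed under intersection, so there is a least one \<open>T\<close> containing \<open>i\<close>; any
    \<open>j \<in> T\<close> can be decreased in exchange for \<open>i\<close>.\<close>
  define tight where "tight I \<longleftrightarrow> I \<subseteq> S \<and> i \<in> I \<and> sum a I = f I" for I
  have "tight S" using i polymatroid_ofD(3)[OF a] by (simp add: tight_def)
  then obtain T where T: "tight T" and min: "\<And>I. tight I \<Longrightarrow> card T \<le> card I"
    using ex_has_least_nat[of tight S card] by blast
  have finI: "finite I" if "I \<subseteq> S" for I using that fin finite_subset by blast
  have sub: "T \<subseteq> I" if I: "tight I" for I
  proof -
    have TI: "T \<subseteq> S" "I \<subseteq> S" using T I by (auto simp: tight_def)
    \<comment> \<open>Uncrossing: since \<open>T\<close> and \<open>I\<close> are tight, the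
      relations below form a chain with equal ends, which forces equality for
      \<open>T \<inter> I\<close>.\<close>
    have "sum a (T \<union> I) + sum a (T \<inter> I) = sum a T + sum a I"
      by (rule sum.union_inter) (use TI finI in auto)
    moreover have "sum a (T \<union> I) \<le> f (T \<union> I)" "sum a (T \<inter> I) \<le> f (T \<inter> I)"
      using TI by (auto intro!: polymatroid_ofD(2)[OF a])
    moreover have "f (T \<union> I) + f (T \<inter> I) \<le> f T + f I"
      by (rule rank_function_submodular[OF rk TI])
    ultimately have "sum a (T \<inter> I) = f (T \<inter> I)"
      using T I by (simp add: tight_def)
    then have "tight (T \<inter> I)" using T I by (auto simp: tight_def)
    then have "card T \<le> card (T \<inter> I)" by (rule min)
    then have "T \<inter> I = T" using finI[OF TI(1)] by (intro card_seteq) auto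
    then show ?thesis by blast
  qed
  have TS: "T \<subseteq> S" "i \<in> T" "sum a T = f T" using T by (auto simp: tight_def)
  \<comment> \<open>Otherwise \<open>b\<close> would dominate \<open>a\<close> on \<open>T\<close>,
    strictly at \<open>i\<close>, and exceed the bound \<open>f T\<close> that \<open>a\<close>
    attains there.\<close>
  have "\<exists>j\<in>T. b j < a j"
  proof (rule ccontr)
    assume "\<not> ?thesis"
    then have "\<forall>j\<in>T. a j \<le> b j" by force
    then have "sum a T < sum b T"
      using TS lt finI by (intro sum_strict_mono_ex1) auto
    also have "\<dots> \<le> f T" by (rule polymatroid_ofD(2)[OF b TS(1)])
    finally show False using TS by simp
  qed
  then obtain j where j: "j \<in> T" "b j < a j" by blast
  have ji: "j \<noteq> i" using j lt by auto
  have jS: "j \<in> S" using j TS by blast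
  let ?a = "a(j := a j - 1, i := a i + 1)"
  have "sum ?a I \<le> f I" if I: "I \<subseteq> S" for I
  proof -
    \<comment> \<open>Only sets with \<open>i\<close> but without \<open>j\<close> gain from the
      move. They are not tight, since every tight set includes \<open>T\<close>, so integrality
      leaves room for one unit.\<close>
    have "sum a I < f I" if "i \<in> I" "j \<notin> I"
    proof -
      have "\<not> tight I" using sub[of I] j that by blast
      then show ?thesis using polymatroid_ofD(2)[OF a I] that I by (auto simp: tight_def)
    qed
    then show ?thesis
      using polymatroid_ofD(2)[OF a I] sum_transfer[OF finI[OF I] ji, of a]
      by (auto simp: of_bool_def)
  qed
  moreover have "sum ?a S = f S"
    using sum_transfer[OF fin ji, of a] jS i polymatroid_ofD(3)[OF a] by simp
  moreover have "?a \<in> S \<rightarrow>\<^sub>E UNIV"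
    using polymatroid_ofD(1)[OF a] i jS by (auto simp: PiE_iff extensional_def)
  ultimately have "?a \<in> polymatroid_of S f" by (simp add: polymatroid_of_def)
  then show ?thesis using j jS by blast
qed

subsection \<open>Independence of the order\<close>

text \<open>Existence half of the decomposition \<open>b = a - c\<close>, with
  \<open>c = a - b\<close>.\<close>

lemma active_above_exists:
  assumes fin: "finite S" and a0: "a0 \<in> polymatroid_of S f" "\<And>i. i \<in> S \<Longrightarrow> b i \<le> a0 i"
  shows "\<exists>a\<in>polymatroid_of S f. (\<forall>i\<in>S. b i \<le> a i) \<and>
           {i \<in> S. b i < a i} \<subseteq> active p S (polymatroid_of S f) a"
proof -
  let ?A = "{a \<in> polymatroid_of S f. \<forall>i\<in>S. b i \<le> a i}"
  \<comment> \<open>A minimizer works: the moves that witness inactivity strictly decrease this weight.\<close>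
  let ?w = "\<lambda>a. \<Sum>i\<in>S. int (p i) * a i"
  have "finite ?A" "?A \<noteq> {}" using finite_polymatroid_of[OF fin] a0 by auto
  then obtain a where a: "a \<in> ?A" and min: "\<And>c. c \<in> ?A \<Longrightarrow> ?w a \<le> ?w c"
    using ex_is_arg_min_if_finite[of ?A ?w] by (auto simp: is_arg_min_linorder)
  have "i \<in> active p S (polymatroid_of S f) a" if i: "i \<in> S" "b i < a i" for i
  proof (rule ccontr)
    assume "i \<notin> active p S (polymatroid_of S f) a"
    then obtain j where j: "j \<in> S" "p j < p i"
      and c: "a(i := a i - 1, j := a j + 1) \<in> polymatroid_of S f"
      using i by (auto simp: active_def)
    let ?c = "a(i := a i - 1, j := a j + 1)"
    have "i \<noteq> j" using j by auto
    then have "?w ?c = (\<Sum>k\<in>S. int (p k) * a k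
        + (if k = j then int (p j) else 0) - (if k = i then int (p i) else 0))"
      by (intro sum.cong) (auto simp: algebra_simps)
    also have "\<dots> = ?w a + int (p j) - int (p i)"
      using fin i j by (simp add: sum.distrib sum_subtractf)
    finally have "?w ?c < ?w a" using j by simp
    moreover have "?c \<in> ?A" using a c i by force
    ultimately show False using min by fastforce
  qed
  then show ?thesis using a by blast
qed

text \<open>Uniqueness half of the decomposition: \<open>b\<close> alone determines
  \<open>a\<close>.\<close>

lemma active_above_unique:
  assumes fin: "finite S" and rk: "is_rank_function S f" and inj: "inj_on p S"
    and a: "a \<in> polymatroid_of S f" and a': "a' \<in> polymatroid_of S f"
    and "\<And>i. i \<in> S \<Longrightarrow> b i \<le> a i" "\<And>i. i \<in> S \<Longrightarrow> b i \<le> a' i"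
    and "{i \<in> S. b i < a i} \<subseteq> active p S (polymatroid_of S f) a"
    and "{i \<in> S. b i < a' i} \<subseteq> active p S (polymatroid_of S f) a'"
  shows "a = a'"
proof (rule ccontr)
  assume neq: "a \<noteq> a'"
  have "\<exists>i\<in>S. a i \<noteq> a' i"
    using PiE_ext[OF polymatroid_ofD(1)[OF a] polymatroid_ofD(1)[OF a']] neq by blast
  then obtain i where i: "i \<in> S" "a i \<noteq> a' i"
    and first: "\<And>j. j \<in> S \<Longrightarrow> a j \<noteq> a' j \<Longrightarrow> p i \<le> p j"
    using ex_has_least_nat[of "\<lambda>i. i \<in> S \<and> a i \<noteq> a' i" _ p] by blast
  \<comment> \<open>By the exchange property the smaller of the two vectors at \<open>i\<close> has an inactive element above \<open>b\<close>.\<close>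
  have no: False
    if c: "c \<in> polymatroid_of S f" and d: "d \<in> polymatroid_of S f"
      and diff: "\<And>j. c j \<noteq> d j \<longleftrightarrow> a j \<noteq> a' j" and lt: "c i < d i"
      and ge: "\<And>j. j \<in> S \<Longrightarrow> b j \<le> d j"
      and act: "{j \<in> S. b j < c j} \<subseteq> active p S (polymatroid_of S f) c" for c d
  proof -
    obtain j where j: "j \<in> S" "d j < c j" "c(j := c j - 1, i := c i + 1) \<in> polymatroid_of S f"
      using polymatroid_exchange[OF fin rk c d i(1) lt] by blast
    have "i \<noteq> j" using j lt by auto
    then have "p i \<noteq> p j" using inj i(1) j(1) by (auto dest: inj_onD)
    \<comment> \<open>\<open>i\<close> is the \<open>p\<close>-least coordinate of disagreement, so
      \<open>j\<close> comes later and the exchange is a move that activity of \<open>j\<close>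
      forbids. But \<open>j\<close> is active because \<open>b j \<le> d j < c j\<close>.\<close>
    moreover have "p i \<le> p j" using first[OF j(1)] diff[of j] j by simp
    ultimately have "p i < p j" by simp
    moreover have "j \<in> active p S (polymatroid_of S f) c"
      using act j ge[OF j(1)] by force
    ultimately show False using j i by (auto simp: active_def)
  qed
  show False
  proof (cases "a i < a' i")
    case True then show ?thesis by (intro no[OF a a']) (use assms in auto)
  next
    case False then show ?thesis by (intro no[OF a' a]) (use assms i in auto)
  qed
qed

section \<open>Generating functions counting the vectors below a polymatroid\<close>

lemma finite_compositions: "finite A \<Longrightarrow> finite {c \<in> A \<rightarrow>\<^sub>E (UNIV :: nat set). sum c A = k}"
  by (rule finite_subset[of _ "A \<rightarrow>\<^sub>E {..k}"])
    (auto simp: subset_iff PiE_iff member_le_sum intro: finite_PiE)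

text \<open>Each element of \<open>A\<close> contributes an independent geometric series
  \<open>1 / (1 - X)\<close>. The product form avoids division, as the coefficients are
  integers.\<close>

lemma fps_compositions:
  assumes "finite A"
  shows "Abs_fps (\<lambda>k. int (card {c \<in> A \<rightarrow>\<^sub>E (UNIV :: nat set). sum c A = k}))
           * (1 - fps_X) ^ card A = 1"
  using assms
proof (induction A rule: finite_induct)
  case empty
  have "{c. c = (\<lambda>_. undefined) \<and> 0 = k} = (if k = (0::nat) then {\<lambda>_::'a. undefined::nat} else {})"
    for k by auto
  then show ?case by (simp add: fps_eq_iff)
next
  case (insert x A)
  let ?C = "\<lambda>A k. {c \<in> A \<rightarrow>\<^sub>E (UNIV :: nat set). sum c A = k}"
  have card: "card (?C (insert x A) k) = (\<Sum>j\<le>k. card (?C A j))" for k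
  proof -
    have upd: "sum (c(x := y)) A = sum c A" for c :: "'a \<Rightarrow> nat" and y
      using insert by (intro sum.cong) auto
    \<comment> \<open>The entries on \<open>A\<close> sum to some \<open>j \<le> k\<close>, which
      determines the entry at \<open>x\<close> as \<open>k - j\<close>. Resetting that entry to
      \<open>undefined\<close> makes the function extensional on \<open>A\<close> again.\<close>
    have "bij_betw (\<lambda>(j, c). c(x := k - j)) (SIGMA j:{..k}. ?C A j) (?C (insert x A) k)"
    proof (rule bij_betw_byWitness[where f' = "\<lambda>c. (sum c A, c(x := undefined))"])
      show "\<forall>q\<in>SIGMA j:{..k}. ?C A j.
          (\<lambda>c. (sum c A, c(x := undefined))) ((\<lambda>(j, c). c(x := k - j)) q) = q"
        using insert upd by (auto simp: fun_eq_iff PiE_iff extensional_def)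
      show "\<forall>c\<in>?C (insert x A) k.
          (\<lambda>(j, c). c(x := k - j)) ((\<lambda>c. (sum c A, c(x := undefined))) c) = c"
        using insert by (auto simp: fun_eq_iff)
      show "(\<lambda>(j, c). c(x := k - j)) ` (SIGMA j:{..k}. ?C A j) \<subseteq> ?C (insert x A) k"
        using insert upd by (auto simp: PiE_iff extensional_def)
      show "(\<lambda>c. (sum c A, c(x := undefined))) ` ?C (insert x A) k \<subseteq> (SIGMA j:{..k}. ?C A j)"
        using insert upd by (auto simp: PiE_iff extensional_def)
    qed
    then have "card (SIGMA j:{..k}. ?C A j) = card (?C (insert x A) k)"
      by (rule bij_betw_same_card)
    moreover have "card (SIGMA j:{..k}. ?C A j) = (\<Sum>j\<le>k. card (?C A j))"
      using finite_compositions[OF insert(1)] by (intro card_SigmaI) auto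
    ultimately show ?thesis by simp
  qed
  \<comment> \<open>Taking partial sums of the coefficients is multiplication by the geometric
    series.\<close>
  have step: "Abs_fps (\<lambda>k. int (card (?C (insert x A) k)))
      = Abs_fps (\<lambda>k. int (card (?C A k))) * Abs_fps (\<lambda>_. 1)"
    by (simp add: fps_eq_iff fps_mult_nth card atLeast0AtMost)
  have geo: "Abs_fps (\<lambda>_. 1) * (1 - fps_X) = (1 :: int fps)"
    by (simp add: fps_eq_iff algebra_simps)
  have "Abs_fps (\<lambda>k. int (card (?C (insert x A) k))) * (1 - fps_X) ^ card (insert x A)
     = (Abs_fps (\<lambda>_. 1) * (1 - fps_X)) *
       (Abs_fps (\<lambda>k. int (card (?C A k))) * (1 - fps_X) ^ card A)"
    unfolding step card_insert_disjoint[OF insert(1,2)] by (simp add: mult_ac)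
  then show ?case unfolding geo insert.IH by simp
qed

lemma pcompose_monom_one: "pcompose (monom 1 n) q = (q :: int poly) ^ n"
  by (induction n) (simp_all add: monom_Suc pcompose_pCons pcompose_1 flip: one_pCons)

text \<open>A slice of the down-closure of \<open>P\<close>. No order on \<open>S\<close> enters, so
  the sizes of these slices can link the activity polynomials of different rankings.\<close>

definition below :: "'a set \<Rightarrow> ('a \<Rightarrow> int) set \<Rightarrow> int \<Rightarrow> ('a \<Rightarrow> int) set" where
  "below S P s = {b \<in> S \<rightarrow>\<^sub>E UNIV. sum b S = s \<and> (\<exists>a\<in>P. \<forall>i\<in>S. b i \<le> a i)}"

text \<open>Over each \<open>a \<in> P\<close> lie the vectors \<open>a - c\<close>, where
  \<open>c\<close> distributes \<open>k\<close> units over the active elements of \<open>a\<close>.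
  By existence and uniqueness these families partition the slice.\<close>

lemma card_below:
  assumes fin: "finite S" and rk: "is_rank_function S f" and inj: "inj_on p S"
  defines "P \<equiv> polymatroid_of S f"
  shows "card (below S P (f S - int k))
    = (\<Sum>a\<in>P. card {c \<in> active p S P a \<rightarrow>\<^sub>E (UNIV :: nat set). sum c (active p S P a) = k})"
proof -
  let ?C = "\<lambda>a. {c \<in> active p S P a \<rightarrow>\<^sub>E (UNIV :: nat set). sum c (active p S P a) = k}"
  define F where "F = (\<lambda>(a, c). \<lambda>i\<in>S. if i \<in> active p S P a then a i - int (c i) else a i)"
  have fa: "finite (active p S P a)" for a
    using fin active_subset finite_subset by metis
  have le: "F (a, c) i \<le> a i" if "i \<in> S" for a c i using that by (simp add: F_def)
  have supp: "{i \<in> S. F (a, c) i < a i} \<subseteq> active p S P a" for a c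
    by (auto simp: F_def split: if_splits)
  have "bij_betw F (Sigma P ?C) (below S P (f S - int k))"
  proof (rule bij_betw_imageI)
    show "inj_on F (Sigma P ?C)"
    proof (rule inj_onI)
      fix q q' assume q: "q \<in> Sigma P ?C" "q' \<in> Sigma P ?C" and eq: "F q = F q'"
      obtain a c a' c' where qq: "q = (a, c)" "q' = (a', c')" by (cases q, cases q')
      have F: "F (a, c) = F (a', c')" using eq qq by simp
      have "F (a, c) i \<le> a' i" if "i \<in> S" for i using le[OF that, of a' c'] F by simp
      moreover have "{i \<in> S. F (a, c) i < a' i} \<subseteq> active p S P a'" using supp[of a' c'] F by simp
      moreover have "a \<in> P" "a' \<in> P" using q qq by auto
      \<comment> \<open>Both \<open>a\<close> and \<open>a'\<close> lie above the common image and
        differ from it only at their own active elements.\<close>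
      ultimately have "a = a'"
        using active_above_unique[OF fin rk inj, of a a' "F (a, c)"] le[of _ a c] supp[of a c]
        unfolding P_def by blast
      have "c i = c' i" if "i \<in> active p S P a" for i
      proof -
        have "F (a, c) i = F (a, c') i" using eq qq \<open>a = a'\<close> by simp
        then show ?thesis using that active_subset[of p S P a] by (auto simp: F_def)
      qed
      then have "c = c'" using q qq \<open>a = a'\<close> by (intro PiE_ext[of c]) auto
      then show "q = q'" using qq \<open>a = a'\<close> by simp
    qed
    show "F ` Sigma P ?C = below S P (f S - int k)"
    proof (intro equalityI subsetI)
      fix b assume "b \<in> F ` Sigma P ?C"
      then obtain a c where ac: "a \<in> P" "c \<in> ?C a" and b: "b = F (a, c)" by blast
      have "sum b S = (\<Sum>i\<in>S. a i - (if i \<in> active p S P a then int (c i) else 0))"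
        unfolding b F_def by (intro sum.cong) auto
      also have "\<dots> = sum a S - int (sum c (active p S P a))"
        using fin active_subset[of p S P a]
        by (simp add: sum_subtractf sum.If_cases Int_absorb1)
      finally have "sum b S = f S - int k"
        using ac polymatroid_ofD(3)[of a S f] by (simp add: P_def del: of_nat_sum)
      moreover have "b \<in> S \<rightarrow>\<^sub>E UNIV" by (simp add: b F_def)
      ultimately show "b \<in> below S P (f S - int k)"
        using ac(1) le[of _ a c] unfolding below_def b by blast
    next
      fix b assume "b \<in> below S P (f S - int k)"
      then obtain a0 where b: "b \<in> S \<rightarrow>\<^sub>E UNIV" "sum b S = f S - int k"
        and a0: "a0 \<in> P" "\<And>i. i \<in> S \<Longrightarrow> b i \<le> a0 i" by (auto simp: below_def)
      obtain a where a: "a \<in> P" "\<And>i. i \<in> S \<Longrightarrow> b i \<le> a i"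
        and act: "{i \<in> S. b i < a i} \<subseteq> active p S P a"
        using active_above_exists[OF fin a0[unfolded P_def], of p] unfolding P_def by blast
      \<comment> \<open>The preimage under \<open>F\<close>; \<open>nat\<close> loses nothing
        because \<open>b \<le> a\<close> on \<open>S\<close>.\<close>
      define c where "c = (\<lambda>i\<in>active p S P a. nat (a i - b i))"
      have "int (sum c (active p S P a)) = (\<Sum>i\<in>active p S P a. a i - b i)"
        unfolding of_nat_sum c_def
        using a(2) active_subset[of p S P a] by (intro sum.cong) auto
      \<comment> \<open>Off the active set \<open>a\<close> and \<open>b\<close> agree by
        \<open>act\<close>, so the added terms vanish.\<close>
      also have "\<dots> = (\<Sum>i\<in>S. a i - b i)"
        using fin active_subset[of p S P a] act a(2) by (intro sum.mono_neutral_left) force+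
      also have "\<dots> = int k"
        using b polymatroid_ofD(3)[of a S f] a by (simp add: sum_subtractf P_def)
      finally have "c \<in> ?C a" by (simp add: c_def del: of_nat_sum)
      moreover have "F (a, c) = b"
      proof
        fix i show "F (a, c) i = b i"
          using a(2)[of i] act b(1) by (auto simp: F_def c_def PiE_iff extensional_def)
      qed
      ultimately show "b \<in> F ` Sigma P ?C" using a by force
    qed
  qed
  then have "card (Sigma P ?C) = card (below S P (f S - int k))"
    by (rule bij_betw_same_card)
  moreover have "card (Sigma P ?C) = (\<Sum>a\<in>P. card (?C a))"
    using finite_polymatroid_of[OF fin, of f] finite_compositions[OF fa]
    by (intro card_SigmaI) (auto simp: P_def)
  ultimately show ?thesis by simp
qed

text \<open>Substituting \<open>1 - t\<close> turns the term of \<open>a\<close> into a power of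
  \<open>1 - t\<close>, which is \<open>(1 - t) ^ card S\<close> times the series of compositions on
  the active set of \<open>a\<close>. Summing over \<open>a\<close> yields the counts of
  \<open>card_below\<close>.\<close>

lemma activity_poly_below:
  assumes fin: "finite S" and rk: "is_rank_function S f" and inj: "inj_on p S"
  defines "P \<equiv> polymatroid_of S f"
  shows "fps_of_poly (pcompose (activity_poly p S P) [:1, -1:])
    = (1 - fps_X) ^ card S * Abs_fps (\<lambda>k. int (card (below S P (f S - int k))))"
proof -
  let ?A = "active p S P"
  let ?G = "\<lambda>a. Abs_fps (\<lambda>k. int (card {c \<in> ?A a \<rightarrow>\<^sub>E (UNIV :: nat set). sum c (?A a) = k}))"
  have fa: "finite (?A a)" "card (?A a) \<le> card S" for a
    using fin active_subset[of p S P a] by (auto intro: finite_subset card_mono)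
  have X: "fps_of_poly [:1, -1:] = (1 - fps_X :: int fps)"
    by (simp add: fps_of_poly_pCons)
  have "Abs_fps (\<lambda>k. int (card (below S P (f S - int k)))) = (\<Sum>a\<in>P. ?G a)"
    using card_below[OF fin rk inj] by (simp add: fps_eq_iff fps_sum_nth P_def)
  then have "(1 - fps_X) ^ card S * Abs_fps (\<lambda>k. int (card (below S P (f S - int k))))
      = (\<Sum>a\<in>P. (1 - fps_X) ^ card S * ?G a)"
    by (simp add: sum_distrib_left)
  also have "\<dots> = (\<Sum>a\<in>P. (1 - fps_X) ^ (card S - card (?A a)))"
  proof (rule sum.cong[OF refl])
    fix a
    have "(1 - fps_X) ^ card S * ?G a
        = (1 - fps_X) ^ (card S - card (?A a)) * (?G a * (1 - fps_X) ^ card (?A a))"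
      using fa(2)[of a] by (simp add: mult_ac flip: power_add)
    then show "(1 - fps_X) ^ card S * ?G a = (1 - fps_X) ^ (card S - card (?A a))"
      using fps_compositions[OF fa(1)[of a]] by simp
  qed
  also have "\<dots> = fps_of_poly (pcompose (activity_poly p S P) [:1, -1:])"
    by (simp add: activity_poly_def pcompose_sum pcompose_monom_one fps_of_poly_sum fps_of_poly_power X)
  finally show ?thesis by simp
qed

text \<open>The right-hand side of \<open>activity_poly_below\<close> does not involve the
  ranking.\<close>

lemma activity_poly_order_independent:
  assumes "finite S" "is_rank_function S f" "inj_on p S" "inj_on q S"
  shows "activity_poly p S (polymatroid_of S f) = activity_poly q S (polymatroid_of S f)"
proof -
  let ?P = "polymatroid_of S f"
  have "pcompose (activity_poly p S ?P) [:1, -1:] = pcompose (activity_poly q S ?P) [:1, -1:]"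
    using activity_poly_below[of S f] assms by (metis fps_of_poly_eq_iff)
  \<comment> \<open>Replacing the variable \<open>x\<close> by \<open>1 - x\<close> is an
    involution, so a second substitution undoes the first.\<close>
  then have "pcompose (pcompose (activity_poly p S ?P) [:1, -1:]) [:1, -1:]
      = pcompose (pcompose (activity_poly q S ?P) [:1, -1:]) [:1, -1:]" by simp
  then show ?thesis by (simp flip: pcompose_assoc add: pcompose_pCons pcompose_idR)
qed

subsection \<open>Faces as products\<close>

lemma is_rank_function_contraction:
  assumes "is_rank_function S f" "T \<subseteq> S"
  shows "is_rank_function (S - T) (\<lambda>I. f (I \<union> T) - f T)"
  unfolding is_rank_function_def
proof (intro conjI allI impI)
  fix I J assume IJ: "I \<subseteq> S - T" "J \<subseteq> S - T"
  have "f ((I \<union> T) \<union> (J \<union> T)) + f ((I \<union> T) \<inter> (J \<union> T)) \<le> f (I \<union> T) + f (J \<union> T)"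
    by (rule rank_function_submodular[OF assms(1)]) (use IJ assms(2) in auto)
  moreover have "(I \<union> T) \<union> (J \<union> T) = I \<union> J \<union> T" "(I \<union> T) \<inter> (J \<union> T) = I \<inter> J \<union> T"
    by auto
  ultimately show "f (I \<union> J \<union> T) - f T + (f (I \<inter> J \<union> T) - f T)
      \<le> f (I \<union> T) - f T + (f (J \<union> T) - f T)" by simp
qed simp

text \<open>Forwards, subtract the equality on \<open>T\<close> from the bound for
  \<open>I \<union> T\<close>. Backwards, add the bounds for \<open>I \<inter> T\<close> and
  \<open>I - T\<close> and apply submodularity to \<open>I\<close> and \<open>T\<close>.\<close>

lemma polymatroid_of_split:
  assumes fin: "finite S" and rk: "is_rank_function S f" and T: "T \<subseteq> S"
    and g: "g \<in> extensional S" and gT: "sum g T = f T"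
  shows "g \<in> polymatroid_of S f \<longleftrightarrow> restrict g T \<in> polymatroid_of T f \<and>
    restrict g (S - T) \<in> polymatroid_of (S - T) (\<lambda>I. f (I \<union> T) - f T)"
    (is "?L \<longleftrightarrow> ?R1 \<and> ?R2")
proof -
  have finI: "finite I" if "I \<subseteq> S" for I using that fin finite_subset by blast
  have restr: "sum (restrict g U) I = sum g I" if "I \<subseteq> U" for I U
    using that by (intro sum.cong) auto
  have union: "sum g (I \<union> T) = sum g I + f T" if "I \<subseteq> S - T" for I
    using that T gT by (subst sum.union_disjoint) (auto intro: finI)
  have ST: "S - T \<union> T = S" using T by blast
  show ?thesis
  proof
    assume L: ?L
    then have "?R1" using T gT polymatroid_ofD(2)[OF L] by (auto simp: polymatroid_of_def restr simp del: restrict_apply)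
    moreover have "sum g I \<le> f (I \<union> T) - f T" if "I \<subseteq> S - T" for I
      using polymatroid_ofD(2)[OF L, of "I \<union> T"] union[OF that] that T by (simp add: subset_iff)
    then have "?R2"
      using union[of "S - T"] polymatroid_ofD(3)[OF L] ST
      by (auto simp: polymatroid_of_def restr simp del: restrict_apply Un_Diff_cancel2)
    ultimately show "?R1 \<and> ?R2" ..
  next
    assume R: "?R1 \<and> ?R2"
    have "sum g I \<le> f I" if I: "I \<subseteq> S" for I
    proof -
      have "sum g I = sum g (I \<inter> T) + sum g (I - T)"
        using finI[OF I] by (rule sum.Int_Diff)
      moreover have "sum g (I \<inter> T) \<le> f (I \<inter> T)"
        using polymatroid_ofD(2)[of "restrict g T" T f "I \<inter> T"] R by (simp add: restr)
      moreover have "I - T \<subseteq> S - T" using I by blast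
      then have "sum g (I - T) \<le> f (I - T \<union> T) - f T"
        using polymatroid_ofD(2)[OF conjunct2[OF R], of "I - T"] restr[of "I - T" "S - T"] by simp
      moreover have "I - T \<union> T = I \<union> T" by blast
      moreover have "f (I \<union> T) + f (I \<inter> T) \<le> f I + f T"
        by (rule rank_function_submodular[OF rk I T])
      ultimately show ?thesis by simp
    qed
    moreover have "sum g S = f S"
      using union[of "S - T"] polymatroid_ofD(3)[OF conjunct2[OF R]]
      by (simp add: restr ST del: Un_Diff_cancel2)
    ultimately show ?L using g by (simp add: polymatroid_of_def PiE_iff)
  qed
qed

text \<open>A move inside \<open>T\<close> or inside \<open>S - T\<close> stays on the face and
  changes one factor only. Moving a unit from outside \<open>T\<close> into \<open>T\<close> would
  push the sum over \<open>T\<close> above \<open>f T\<close>; the opposite moves are not tested, as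
  \<open>T\<close> comes first.\<close>

lemma active_split:
  assumes fin: "finite S" and rk: "is_rank_function S f" and T: "T \<subseteq> S"
    and g: "g \<in> polymatroid_of S f" and gT: "sum g T = f T"
    and p: "\<forall>i\<in>T. \<forall>j\<in>S - T. p i < p j"
  shows "active p S (polymatroid_of S f) g =
    active p T (polymatroid_of T f) (restrict g T) \<union>
    active p (S - T) (polymatroid_of (S - T) (\<lambda>I. f (I \<union> T) - f T)) (restrict g (S - T))"
    (is "?A = ?A1 \<union> ?A2")
proof -
  have finT: "finite T" using T fin finite_subset by blast
  let ?m = "\<lambda>(a :: 'a \<Rightarrow> int) i j. a(i := a i - 1, j := a j + 1)"
  let ?P2 = "polymatroid_of (S - T) (\<lambda>I. f (I \<union> T) - f T)"
  have R: "restrict g T \<in> polymatroid_of T f" "restrict g (S - T) \<in> ?P2"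
    using polymatroid_of_split[OF fin rk T _ gT] g by (auto simp: polymatroid_of_def PiE_iff)
  have ext: "?m g i j \<in> extensional S" if "i \<in> S" "j \<in> S" for i j
    using polymatroid_ofD(1)[OF g] that by (auto simp: PiE_iff extensional_def)
  have mT: "?m g i j \<in> polymatroid_of S f \<longleftrightarrow> ?m (restrict g T) i j \<in> polymatroid_of T f"
    if "i \<in> T" "j \<in> T" "i \<noteq> j" for i j
  proof -
    have "restrict (?m g i j) T = ?m (restrict g T) i j"
      "restrict (?m g i j) (S - T) = restrict g (S - T)"
      using that by (auto simp: fun_eq_iff)
    moreover have "sum (?m g i j) T = f T"
      using sum_transfer[OF finT that(3), of g] that gT by simp
    ultimately show ?thesis
      using polymatroid_of_split[OF fin rk T ext[of i j]] that T R by auto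
  qed
  have mS: "?m g i j \<in> polymatroid_of S f \<longleftrightarrow> ?m (restrict g (S - T)) i j \<in> ?P2"
    if "i \<in> S - T" "j \<in> S - T" "i \<noteq> j" for i j
  proof -
    have "restrict (?m g i j) (S - T) = ?m (restrict g (S - T)) i j"
      "restrict (?m g i j) T = restrict g T"
      using that by (auto simp: fun_eq_iff)
    moreover have "sum (?m g i j) T = f T"
      using sum_transfer[OF finT that(3), of g] that gT by simp
    ultimately show ?thesis
      using polymatroid_of_split[OF fin rk T ext[of i j]] that T R by auto
  qed
  have mST: "?m g i j \<notin> polymatroid_of S f" if "i \<in> S - T" "j \<in> T" for i j
  proof
    assume "?m g i j \<in> polymatroid_of S f"
    then have "sum (?m g i j) T \<le> f T" using polymatroid_ofD(2) T by blast
    moreover have "i \<noteq> j" using that by auto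
    ultimately show False using sum_transfer[OF finT, of i j g] that gT by simp
  qed
  have "i \<in> ?A \<longleftrightarrow> i \<in> ?A1 \<union> ?A2" for i
  proof -
    consider "i \<in> T" | "i \<in> S - T" | "i \<notin> S" by blast
    then show ?thesis
    proof cases
      case 1
      then have first: "j \<in> T" if "j \<in> S" "p j < p i" for j
        using p that by (meson DiffI less_asym)
      from 1 have "i \<in> ?A \<longleftrightarrow> (\<forall>j\<in>T. p j < p i \<longrightarrow> ?m g i j \<notin> polymatroid_of S f)"
        using T first unfolding active_def by blast
      also have "\<dots> \<longleftrightarrow> i \<in> ?A1"
        using 1 mT[of i] unfolding active_def by (auto)
      finally show ?thesis using 1 by (auto simp: active_def)
    next
      case 2
      then have "i \<in> ?A \<longleftrightarrow> (\<forall>j\<in>S - T. p j < p i \<longrightarrow> ?m g i j \<notin> polymatroid_of S f)"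
        using mST[OF 2] unfolding active_def by blast
      also have "\<dots> \<longleftrightarrow> i \<in> ?A2"
        using 2 mS[of i] unfolding active_def by (auto)
      finally show ?thesis using 2 by (auto simp: active_def)
    next
      case 3 then show ?thesis using T by (auto simp: active_def)
    qed
  qed
  then show ?thesis by blast
qed

text \<open>For a vector \<open>b\<close> strictly below all points of the polymatroid, the set
  required to be active is all of \<open>S\<close>.\<close>

lemma all_active_exists:
  assumes fin: "finite S" and rk: "is_rank_function S f"
  shows "\<exists>a\<in>polymatroid_of S f. active p S (polymatroid_of S f) a = S"
proof -
  let ?P = "polymatroid_of S f"
  obtain a0 where a0: "a0 \<in> ?P" using rank_function_attained[OF fin rk, of "{}"] by auto
  \<comment> \<open>Coordinatewise minimum over the finite nonempty \<open>?P\<close>, lowered by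
    one to make the inequalities strict.\<close>
  define b where "b i = Min ((\<lambda>a. a i) ` ?P) - 1" for i
  have b: "b i < a i" if "a \<in> ?P" for a i
  proof -
    have "Min ((\<lambda>a. a i) ` ?P) \<le> a i"
      using finite_polymatroid_of[OF fin] that by (intro Min_le) auto
    then show ?thesis by (simp add: b_def)
  qed
  obtain a where a: "a \<in> ?P" "{i \<in> S. b i < a i} \<subseteq> active p S ?P a"
    using active_above_exists[OF fin a0, of b p] b[OF a0] by (auto intro: less_imp_le)
  then have "active p S ?P a = S" using b[OF a(1)] active_subset[of p S ?P a] by blast
  then show ?thesis using a by blast
qed

text \<open>Take any injective ranking and shift its values outside \<open>T\<close> past all its
  values on \<open>S\<close>.\<close>

lemma order_with_initial_segment:
  assumes "finite S"
  obtains p :: "'a \<Rightarrow> nat" where "inj_on p S" "\<forall>i\<in>S \<inter> T. \<forall>j\<in>S - T. p i < p j"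
proof -
  obtain q :: "'a \<Rightarrow> nat" and n where q: "q ` S = {i. i < n}" "inj_on q S"
    using finite_imp_inj_to_nat_seg[OF assms] by auto
  then have "\<And>i. i \<in> S \<Longrightarrow> q i < n" by blast
  then have lt: "q i < n + q j" if "i \<in> S" for i j using that by (simp add: trans_less_add1)
  show ?thesis
  proof (rule that[of "\<lambda>i. if i \<in> T then q i else n + q i"])
    show "inj_on (\<lambda>i. if i \<in> T then q i else n + q i) S"
    proof (rule inj_onI)
      fix i j assume "i \<in> S" "j \<in> S"
        and "(if i \<in> T then q i else n + q i) = (if j \<in> T then q j else n + q j)"
      then show "i = j" using lt[of i j] lt[of j i] inj_onD[OF q(2), of i j] by (simp split: if_splits)
    qed
  qed (use lt in simp)
qed

section \<open>Gluing the two factors of a face\<close>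

definition glue :: "'a set \<Rightarrow> ('a \<Rightarrow> int) \<Rightarrow> ('a \<Rightarrow> int) \<Rightarrow> 'a \<Rightarrow> int" where
  "glue T x y = (\<lambda>i. if i \<in> T then x i else y i)"

lemma glue_polymatroid_of:
  assumes fin: "finite S" and rk: "is_rank_function S f" and T: "T \<subseteq> S"
    and x: "x \<in> polymatroid_of T f"
    and y: "y \<in> polymatroid_of (S - T) (\<lambda>I. f (I \<union> T) - f T)"
  shows "restrict (glue T x y) T = x" "restrict (glue T x y) (S - T) = y"
    "sum (glue T x y) T = f T" "glue T x y \<in> polymatroid_of S f"
proof -
  show r: "restrict (glue T x y) T = x" "restrict (glue T x y) (S - T) = y"
    using polymatroid_ofD(1)[OF x] polymatroid_ofD(1)[OF y]
    by (auto simp: glue_def fun_eq_iff PiE_iff extensional_def)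
  show s: "sum (glue T x y) T = f T"
    using polymatroid_ofD(3)[OF x] by (simp add: glue_def)
  have "glue T x y \<in> extensional S"
    using polymatroid_ofD(1)[OF x] polymatroid_ofD(1)[OF y] T
    by (auto simp: glue_def PiE_iff extensional_def)
  then show "glue T x y \<in> polymatroid_of S f"
    using polymatroid_of_split[OF fin rk T _ s] r x y by simp
qed

lemma card_active_glue:
  assumes fin: "finite S" and rk: "is_rank_function S f" and T: "T \<subseteq> S"
    and x: "x \<in> polymatroid_of T f"
    and y: "y \<in> polymatroid_of (S - T) (\<lambda>I. f (I \<union> T) - f T)"
    and p: "\<forall>i\<in>T. \<forall>j\<in>S - T. p i < p j"
  shows "card (active p S (polymatroid_of S f) (glue T x y)) =
    card (active p T (polymatroid_of T f) x) +
    card (active p (S - T) (polymatroid_of (S - T) (\<lambda>I. f (I \<union> T) - f T)) y)"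
proof -
  note G = glue_polymatroid_of[OF fin rk T x y]
  have "finite T" using T fin finite_subset by blast
  then show ?thesis
    unfolding active_split[OF fin rk T G(4) G(3) p] G(1,2)
    using fin by (intro card_Un_disjoint) (auto simp: active_def)
qed

text \<open>The embeddings are built for a ranking \<open>p\<close> that puts \<open>T\<close>
  first; order independence then carries both inequalities over to the given
  \<open>q\<close>.\<close>

lemma activity_poly_restriction_contraction:
  assumes fin: "finite S" and rk: "is_rank_function S f" and T: "T \<subseteq> S" and q: "inj_on q S"
  shows "coeffwise_le (activity_poly q T (polymatroid_of T f)) (activity_poly q S (polymatroid_of S f))"
    and "coeffwise_le (activity_poly q (S - T) (polymatroid_of (S - T) (\<lambda>I. f (I \<union> T) - f T)))
      (activity_poly q S (polymatroid_of S f))"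
proof -
  let ?h = "\<lambda>I. f (I \<union> T) - f T"
  let ?P = "polymatroid_of S f" and ?P1 = "polymatroid_of T f" and ?P2 = "polymatroid_of (S - T) ?h"
  have finT: "finite T" "finite (S - T)" using T fin finite_subset by auto
  have rk1: "is_rank_function T f" using rk T by (rule is_rank_function_mono)
  have rk2: "is_rank_function (S - T) ?h" using rk T by (rule is_rank_function_contraction)
  obtain p :: "'a \<Rightarrow> nat" where p: "inj_on p S" "\<forall>i\<in>T. \<forall>j\<in>S - T. p i < p j"
    using order_with_initial_segment[OF fin, of T] T by (metis inf.absorb2)
  have inj: "inj_on r T" "inj_on r (S - T)" if "inj_on r S" for r :: "'a \<Rightarrow> nat"
    by (rule inj_on_subset[OF that], use T in blast)+
  \<comment> \<open>Fixed vectors for the other factor: being entirely active, they add nothing to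
    the number of inactive elements.\<close>
  obtain x0 where x0: "x0 \<in> ?P1" "active p T ?P1 x0 = T"
    using all_active_exists[OF finT(1) rk1] by blast
  obtain y0 where y0: "y0 \<in> ?P2" "active p (S - T) ?P2 y0 = S - T"
    using all_active_exists[OF finT(2) rk2] by blast
  note glue = glue_polymatroid_of[OF fin rk T] and act = card_active_glue[OF fin rk T _ _ p(2)]
  have card: "card S = card T + card (S - T)"
    using T fin finT by (simp add: card_Diff_subset card_mono)
  have "coeffwise_le (activity_poly p T ?P1) (activity_poly p S ?P)"
  proof (rule activity_poly_coeffwise_le[where F = "\<lambda>x. glue T x y0"])
    show "inj_on (\<lambda>x. glue T x y0) ?P1"
      by (rule inj_on_inverseI[where g = "\<lambda>g. restrict g T"]) (rule glue(1)[OF _ y0(1)])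
    show "(\<lambda>x. glue T x y0) ` ?P1 \<subseteq> ?P" using glue(4)[OF _ y0(1)] by blast
    show "card T - card (active p T ?P1 a) = card S - card (active p S ?P (glue T a y0))"
      if "a \<in> ?P1" for a using act[OF that y0(1)] y0(2) card by simp
  qed (use fin finT finite_polymatroid_of in blast)+
  then show "coeffwise_le (activity_poly q T ?P1) (activity_poly q S ?P)"
    using activity_poly_order_independent p(1) q inj fin finT rk rk1 by metis
  have "coeffwise_le (activity_poly p (S - T) ?P2) (activity_poly p S ?P)"
  proof (rule activity_poly_coeffwise_le[where F = "\<lambda>y. glue T x0 y"])
    show "inj_on (\<lambda>y. glue T x0 y) ?P2"
      by (rule inj_on_inverseI[where g = "\<lambda>g. restrict g (S - T)"]) (rule glue(2)[OF x0(1)])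
    show "(\<lambda>y. glue T x0 y) ` ?P2 \<subseteq> ?P" using glue(4)[OF x0(1)] by blast
    show "card (S - T) - card (active p (S - T) ?P2 a)
        = card S - card (active p S ?P (glue T x0 a))"
      if "a \<in> ?P2" for a using act[OF x0(1) that] x0(2) card by simp
  qed (use fin finT finite_polymatroid_of in blast)+
  then show "coeffwise_le (activity_poly q (S - T) ?P2) (activity_poly q S ?P)"
    using activity_poly_order_independent[OF fin rk p(1) q]
      activity_poly_order_independent[OF finT(2) rk2 inj(2)[OF p(1)] inj(2)[OF q]] by simp
qed

text \<open>The intermediate polymatroid is the contraction by \<open>B\<close>, of which the minor
  is a restriction.\<close>

lemma activity_poly_minor:
  assumes fin: "finite S" and rk: "is_rank_function S f" and q: "inj_on q S"
    and AB: "A \<subseteq> S" "B \<subseteq> S" "A \<inter> B = {}"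
  shows "coeffwise_le
    (activity_poly q (S - (A \<union> B)) (polymatroid_of (S - (A \<union> B)) (\<lambda>I. f (I \<union> B) - f B)))
    (activity_poly q S (polymatroid_of S f))"
proof (rule coeffwise_le_trans)
  show "coeffwise_le
    (activity_poly q (S - (A \<union> B)) (polymatroid_of (S - (A \<union> B)) (\<lambda>I. f (I \<union> B) - f B)))
    (activity_poly q (S - B) (polymatroid_of (S - B) (\<lambda>I. f (I \<union> B) - f B)))"
    by (rule activity_poly_restriction_contraction(1))
      (use fin inj_on_subset[OF q] is_rank_function_contraction[OF rk AB(2)] in auto)
  show "coeffwise_le
    (activity_poly q (S - B) (polymatroid_of (S - B) (\<lambda>I. f (I \<union> B) - f B)))
    (activity_poly q S (polymatroid_of S f))"
    by (rule activity_poly_restriction_contraction(2)[OF fin rk AB(2) q])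
qed

subsection \<open>Duality\<close>

text \<open>Rank function of \<open>-P\<close>: since \<open>sum a S = f S\<close>, the negated sum
  over \<open>I\<close> is \<open>sum a (S - I) - f S\<close>, and its maximum over \<open>P\<close>
  is this value.\<close>

definition dual_rank :: "'a set \<Rightarrow> ('a set \<Rightarrow> int) \<Rightarrow> 'a set \<Rightarrow> int" where
  "dual_rank S f I = f (S - I) - f S"

definition negate :: "'a set \<Rightarrow> ('a \<Rightarrow> int) \<Rightarrow> 'a \<Rightarrow> int" where
  "negate S a = (\<lambda>i\<in>S. - a i)"

lemma is_rank_function_dual:
  assumes "is_rank_function S f"
  shows "is_rank_function S (dual_rank S f)"
  unfolding is_rank_function_def dual_rank_def
proof (intro conjI allI impI)
  fix I J assume "I \<subseteq> S" "J \<subseteq> S"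
  have "f ((S - I) \<union> (S - J)) + f ((S - I) \<inter> (S - J)) \<le> f (S - I) + f (S - J)"
    by (rule rank_function_submodular[OF assms]) auto
  moreover have "(S - I) \<union> (S - J) = S - (I \<inter> J)" "(S - I) \<inter> (S - J) = S - (I \<union> J)" by auto
  ultimately show "f (S - (I \<union> J)) - f S + (f (S - I \<inter> J) - f S)
      \<le> f (S - I) - f S + (f (S - J) - f S)" by simp
qed simp

lemma negate_negate: "a \<in> S \<rightarrow>\<^sub>E UNIV \<Longrightarrow> negate S (negate S a) = a"
  by (auto simp: negate_def fun_eq_iff PiE_iff extensional_def)

lemma negate_in_dual:
  assumes "finite S" "f {} = 0" "a \<in> polymatroid_of S f"
  shows "negate S a \<in> polymatroid_of S (dual_rank S f)"
proof -
  have neg: "sum (negate S a) I = sum a (S - I) - f S" if "I \<subseteq> S" for I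
  proof -
    have "sum (negate S a) I = - sum a I"
      using that by (auto simp: negate_def subset_iff simp flip: sum_negf intro!: sum.cong)
    then show ?thesis
      using sum.subset_diff[OF that assms(1), of a] polymatroid_ofD(3)[OF assms(3)] by simp
  qed
  have "negate S a \<in> S \<rightarrow>\<^sub>E UNIV" by (simp add: negate_def)
  then show ?thesis
    using assms(2) polymatroid_ofD(2)[OF assms(3)]
    by (simp add: polymatroid_of_def dual_rank_def neg)
qed

lemma dual_rank_dual_rank:
  assumes "f {} = 0" "I \<subseteq> S"
  shows "dual_rank S (dual_rank S f) I = f I"
  using assms by (simp add: dual_rank_def double_diff)

lemma negate_in_dual_iff:
  assumes "finite S" "f {} = 0" "a \<in> S \<rightarrow>\<^sub>E UNIV"
  shows "negate S a \<in> polymatroid_of S (dual_rank S f) \<longleftrightarrow> a \<in> polymatroid_of S f"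
proof
  assume "negate S a \<in> polymatroid_of S (dual_rank S f)"
  then have "a \<in> polymatroid_of S (dual_rank S (dual_rank S f))"
    using negate_in_dual[OF assms(1), of "dual_rank S f" "negate S a"] negate_negate[OF assms(3)]
    by (simp add: dual_rank_def)
  \<comment> \<open>Dualizing twice returns \<open>f\<close> on the subsets of \<open>S\<close>,
    which are all that \<open>polymatroid_of\<close> inspects.\<close>
  also have "\<dots> = polymatroid_of S f"
    by (rule polymatroid_of_cong) (rule dual_rank_dual_rank[where f = f, OF assms(2)])
  finally show "a \<in> polymatroid_of S f" .
qed (rule negate_in_dual[where f = f, OF assms(1,2)])

section \<open>Back to the given linear order and to minors\<close>

lemma interior_poly_eq_activity_poly:
  fixes p :: "'a::linorder \<Rightarrow> nat"
  assumes "\<And>i j. i \<in> S \<Longrightarrow> j \<in> S \<Longrightarrow> p i < p j \<longleftrightarrow> i < j"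
  shows "interior_poly S P = activity_poly p S P"
proof -
  have "internally_active S P a = active p S P a" for a
    using assms by (auto simp: internally_active_def active_def)
  then show ?thesis by (simp add: interior_poly_def activity_poly_def)
qed

lemma exterior_poly_eq_activity_poly:
  fixes p :: "'a::linorder \<Rightarrow> nat"
  assumes p: "\<And>i j. i \<in> S \<Longrightarrow> j \<in> S \<Longrightarrow> p i < p j \<longleftrightarrow> i < j"
    and fin: "finite S" and f: "f {} = 0"
  shows "exterior_poly S (polymatroid_of S f)
    = activity_poly p S (polymatroid_of S (dual_rank S f))"
  unfolding exterior_poly_def activity_poly_def
proof (rule sum.reindex_bij_witness[where i = "negate S" and j = "negate S"])
  fix a assume a: "a \<in> polymatroid_of S f"
  note aS = polymatroid_ofD(1)[OF a]
  show "negate S (negate S a) = a" by (rule negate_negate[OF aS])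
  show "negate S a \<in> polymatroid_of S (dual_rank S f)" by (rule negate_in_dual[where f = f, OF fin f a])
  \<comment> \<open>Negation turns an exterior move at \<open>a\<close> into an interior move at
    \<open>-a\<close>.\<close>
  have "(negate S a)(i := negate S a i - 1, j := negate S a j + 1) \<in> polymatroid_of S (dual_rank S f)
      \<longleftrightarrow> a(i := a i + 1, j := a j - 1) \<in> polymatroid_of S f" if ij: "i \<in> S" "j \<in> S" for i j
  proof -
    have "(negate S a)(i := negate S a i - 1, j := negate S a j + 1)
        = negate S (a(i := a i + 1, j := a j - 1))"
      using ij by (auto simp: negate_def fun_eq_iff)
    moreover have "a(i := a i + 1, j := a j - 1) \<in> S \<rightarrow>\<^sub>E UNIV"
      using ij aS by (auto simp: PiE_iff extensional_def)
    ultimately show ?thesis using negate_in_dual_iff[where f = f, OF fin f] by simp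
  qed
  then have "active p S (polymatroid_of S (dual_rank S f)) (negate S a)
      = externally_active S (polymatroid_of S f) a"
    using p by (auto simp: active_def externally_active_def)
  then show "monom 1 (card S - card (active p S (polymatroid_of S (dual_rank S f)) (negate S a)))
      = (monom 1 (card S - card (externally_active S (polymatroid_of S f) a)) :: int poly)"
    by simp
next
  fix b assume b: "b \<in> polymatroid_of S (dual_rank S f)"
  show bb: "negate S (negate S b) = b" by (rule negate_negate[OF polymatroid_ofD(1)[OF b]])
  have "negate S b \<in> S \<rightarrow>\<^sub>E UNIV" by (simp add: negate_def)
  then show "negate S b \<in> polymatroid_of S f"
    using negate_in_dual_iff[where f = f, OF fin f] bb b by metis
qed

text \<open>Deletion and contraction commute, so the two cases of \<open>is_minor\<close> merge into
  one.\<close>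

lemma minor_eq_polymatroid_of:
  assumes fin: "finite S" and rk: "is_rank_function S f"
    and AB: "A \<subseteq> S" "B \<subseteq> S" "A \<inter> B = {}"
  shows "contraction (S - A) (deletion S (polymatroid_of S f) A) B
      = polymatroid_of (S - (A \<union> B)) (\<lambda>I. f (I \<union> B) - f B)"
    and "deletion (S - B) (contraction S (polymatroid_of S f) B) A
      = polymatroid_of (S - (A \<union> B)) (\<lambda>I. f (I \<union> B) - f B)"
proof -
  have eq: "S - A - B = S - (A \<union> B)" "S - B - A = S - (A \<union> B)" by auto
  have "is_rank_function (S - A) f" using rk by (rule is_rank_function_mono) auto
  moreover have "B \<subseteq> S - A" using AB by auto
  ultimately show "contraction (S - A) (deletion S (polymatroid_of S f) A) B
      = polymatroid_of (S - (A \<union> B)) (\<lambda>I. f (I \<union> B) - f B)"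
    using fin rk by (simp add: deletion_polymatroid_of contraction_polymatroid_of eq)
  show "deletion (S - B) (contraction S (polymatroid_of S f) B) A
      = polymatroid_of (S - (A \<union> B)) (\<lambda>I. f (I \<union> B) - f B)"
    using fin is_rank_function_contraction[OF rk AB(2)]
    by (simp add: contraction_polymatroid_of[OF fin rk AB(2)] deletion_polymatroid_of eq)
qed

text \<open>The negated minor arises from \<open>-P\<close> by contracting \<open>A\<close> and
  deleting \<open>B\<close>.\<close>

lemma dual_rank_minor:
  assumes "B \<subseteq> S" "A \<inter> B = {}" "I \<subseteq> S - (A \<union> B)"
  shows "dual_rank (S - (A \<union> B)) (\<lambda>I. f (I \<union> B) - f B) I
    = dual_rank S f (I \<union> A) - dual_rank S f A"
proof -
  have "S - (A \<union> B) - I \<union> B = S - (I \<union> A)" "S - (A \<union> B) \<union> B = S - A" using assms by auto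
  then show ?thesis by (simp add: dual_rank_def)
qed

theorem theorem4p7:
  fixes S S' :: "'a::linorder set" and P P' :: "('a \<Rightarrow> int) set"
  assumes "is_polymatroid S P"
    and "is_minor S' P' S P"
  shows "coeffwise_le (interior_poly S' P') (interior_poly S P) \<and>
         coeffwise_le (exterior_poly S' P') (exterior_poly S P)"
proof -
  obtain f where fin: "finite S" and rk: "is_rank_function S f" and P: "P = polymatroid_of S f"
    using assms(1) by (auto simp: is_polymatroid_def)
  obtain A B where AB: "A \<subseteq> S" "B \<subseteq> S" "A \<inter> B = {}" and S': "S' = S - (A \<union> B)"
    and "P' = contraction (S - A) (deletion S P A) B \<or> P' = deletion (S - B) (contraction S P B) A"
    using assms(2) by (auto simp: is_minor_def)
  then have P': "P' = polymatroid_of S' (\<lambda>I. f (I \<union> B) - f B)"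
    using minor_eq_polymatroid_of[OF fin rk AB] by (auto simp: P)
  \<comment> \<open>The position in \<open>S\<close> also induces the given order on the smaller
    \<open>S'\<close>, so one ranking serves both ground sets.\<close>
  define p where "p i = card {j \<in> S. j < i}" for i
  have mono: "p i < p j" if "i \<in> S" "i < j" for i j
    unfolding p_def using that fin by (intro psubset_card_mono) auto
  have p: "p i < p j \<longleftrightarrow> i < j" if "i \<in> S" "j \<in> S" for i j
    using mono[of i j] mono[of j i] that by (metis less_asym less_irrefl linorder_neqE)
  have inj: "inj_on p S"
    by (rule inj_onI) (metis p less_irrefl linorder_neqE)
  have pS': "p i < p j \<longleftrightarrow> i < j" if "i \<in> S'" "j \<in> S'" for i j
    using p that S' by simp
  have "f {} = 0" using rk by (simp add: is_rank_function_def)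
  moreover have "finite S'" using fin S' by simp
  ultimately have ext: "exterior_poly S P = activity_poly p S (polymatroid_of S (dual_rank S f))"
    "exterior_poly S' P' = activity_poly p S' (polymatroid_of S' (dual_rank S' (\<lambda>I. f (I \<union> B) - f B)))"
    unfolding P P' by (simp_all add: exterior_poly_eq_activity_poly p pS' fin)
  have "polymatroid_of S' (dual_rank S' (\<lambda>I. f (I \<union> B) - f B))
      = polymatroid_of S' (\<lambda>I. dual_rank S f (I \<union> A) - dual_rank S f A)"
    by (rule polymatroid_of_cong) (use dual_rank_minor[OF AB(2,3)] S' in simp)
  \<comment> \<open>\<open>activity_poly_minor\<close> is applied to the dual rank function with
    \<open>A\<close> and \<open>B\<close> interchanged.\<close>
  moreover have "coeffwise_le
      (activity_poly p S' (polymatroid_of S' (\<lambda>I. dual_rank S f (I \<union> A) - dual_rank S f A)))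
      (activity_poly p S (polymatroid_of S (dual_rank S f)))"
    using activity_poly_minor[OF fin is_rank_function_dual[OF rk] inj AB(2,1)] AB(3) S'
    by (simp add: Un_commute Int_commute)
  ultimately have "coeffwise_le (exterior_poly S' P') (exterior_poly S P)"
    by (simp add: ext)
  moreover have "interior_poly S P = activity_poly p S P" "interior_poly S' P' = activity_poly p S' P'"
    by (simp_all add: interior_poly_eq_activity_poly p pS')
  then have "coeffwise_le (interior_poly S' P') (interior_poly S P)"
    using activity_poly_minor[OF fin rk inj AB] by (simp add: P P' S')
  ultimately show ?thesis by blast
qed

end
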